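(* Let $\alpha>0$, $\alpha\neq1$, and let $\mathfrak{g}=\mathfrak{g}_{3.4}^{\alpha}\oplus\mathfrak{g}_1$ be the four-dimensional real Lie algebra with basis $\mathcal{B}=\{e_1,e_2,e_3,e_4\}$ whose nonzero Lie brackets (up to skew-symmetry) are $[e_2,e_3]=e_1-\alpha e_2$, $[e_3,e_1]=\alpha e_1-e_2$. Let $\langle\cdot,\cdot\rangle$ be a pseudo-Riemannian inner product on $\mathfrak{g}$ and let $(R_{ij})$ be the matrix of its Ricci operator $\operatorname{Ric}$ in the basis $\mathcal{B}$. If $$R_{i1}=R_{i2}=0\ (i=3,4),\quad R_{i4}=0\ (i=1,2,3),\quad R_{21}=R_{12},\quad R_{22}=R_{11},$$ then $\langle\cdot,\cdot\rangle$ is an algebraic Ricci soliton. In this situation, $\operatorname{Ric}=\eta I_4+D$ where $\eta=R_{33}$ and $$D=\begin{bmatrix}R_{11}-R_{33}&R_{12}&R_{13}&0\\R_{12}&R_{11}-R_{33}&R_{23}&0\\0&0&0&0\\0&0&R_{43}&R_{44}-R_{33}\end{bmatrix}$$ is (the matrix in the basis $\mathcal{B}$ of) a derivation of $\mathfrak{g}$.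
   Context: A pseudo-Riemannian inner product on a real Lie algebra $\mathfrak{g}$ is a nondegenerate symmetric bilinear form $\langle\cdot,\cdot\rangle$ on $\mathfrak{g}$ (of some signature $(r,s)$). Its Levi-Civita connection $\nabla$ is defined by $2\langle\nabla_uv,w\rangle=\langle[u,v],w\rangle+\langle[w,u],v\rangle+\langle[w,v],u\rangle$; its curvature is $R_{uv}=\nabla_{[u,v]}-[\nabla_u,\nabla_v]$; its Ricci curvature $\operatorname{ric}(u,v)$ is the trace of $w\mapsto R_{uw}v$; its Ricci operator $\operatorname{Ric}$ is the endomorphism of $\mathfrak{g}$ with $\langle\operatorname{Ric}(u),v\rangle=\operatorname{ric}(u,v)$. The matrix $(R_{ij})$ of $\operatorname{Ric}$ in a basis $\{e_i\}$ is given by $\operatorname{Ric}(e_j)=\sum_iR_{ij}e_i$ (the same column convention is used for $D$). A derivation is a linear map $D:\mathfrak{g}\to\mathfrak{g}$ with $D[x,y]=[D(x),y]+[x,D(y)]$ for all $x,y$. The inner product is an algebraic Ricci soliton if $\operatorname{Ric}=\eta\,\mathrm{Id}_{\mathfrak{g}}+D$ for some $\eta\in\mathbb{R}$ and some derivation $D$ of $\mathfrak{g}$. *)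

theory Defs
  imports "HOL-Analysis.Analysis"
begin

text \<open>Lie algebra structures and inner products are considered on the real vector space
  \<^typ>\<open>real ^ 'n\<close>, whose standard basis plays the role of the distinguished basis; the Euclidean
  inner product of this type is never used.\<close>

definition lie_algebra :: "(real ^ 'n \<Rightarrow> real ^ 'n \<Rightarrow> real ^ 'n) \<Rightarrow> bool" where
  "lie_algebra br \<longleftrightarrow> bilinear br \<and> (\<forall>x. br x x = 0) \<and>
     (\<forall>x y z. br x (br y z) + br y (br z x) + br z (br x y) = 0)"

definition derivation :: "(real ^ 'n \<Rightarrow> real ^ 'n \<Rightarrow> real ^ 'n) \<Rightarrow> (real ^ 'n \<Rightarrow> real ^ 'n) \<Rightarrow> bool" where
  "derivation br D \<longleftrightarrow> linear D \<and> (\<forall>x y. D (br x y) = br (D x) y + br x (D y))"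

definition pseudo_riemannian :: "(real ^ 'n \<Rightarrow> real ^ 'n \<Rightarrow> real) \<Rightarrow> bool" where
  "pseudo_riemannian g \<longleftrightarrow> bilinear g \<and> (\<forall>x y. g x y = g y x) \<and>
     (\<forall>x. (\<forall>y. g x y = 0) \<longrightarrow> x = 0)"

text \<open>The definite descriptions below are well defined when \<open>br\<close> is bilinear and \<open>g\<close> is
  pseudo-Riemannian; nothing is meant outside this case.\<close>

definition levi_civita ::
  "(real ^ 'n \<Rightarrow> real ^ 'n \<Rightarrow> real ^ 'n) \<Rightarrow> (real ^ 'n \<Rightarrow> real ^ 'n \<Rightarrow> real) \<Rightarrow>
    real ^ 'n \<Rightarrow> real ^ 'n \<Rightarrow> real ^ 'n" where
  "levi_civita br g u v =
     (THE x. \<forall>w. 2 * g x w = g (br u v) w + g (br w u) v + g (br w v) u)"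

definition curvature ::
  "(real ^ 'n \<Rightarrow> real ^ 'n \<Rightarrow> real ^ 'n) \<Rightarrow> (real ^ 'n \<Rightarrow> real ^ 'n \<Rightarrow> real) \<Rightarrow>
    real ^ 'n \<Rightarrow> real ^ 'n \<Rightarrow> real ^ 'n \<Rightarrow> real ^ 'n" where
  "curvature br g u v x =
     levi_civita br g (br u v) x
     - (levi_civita br g u (levi_civita br g v x) - levi_civita br g v (levi_civita br g u x))"

definition ricci_curvature ::
  "(real ^ 'n \<Rightarrow> real ^ 'n \<Rightarrow> real ^ 'n) \<Rightarrow> (real ^ 'n \<Rightarrow> real ^ 'n \<Rightarrow> real) \<Rightarrow>
    real ^ 'n \<Rightarrow> real ^ 'n \<Rightarrow> real" where
  "ricci_curvature br g u v = trace (matrix (\<lambda>w. curvature br g u w v))"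

definition ricci_operator ::
  "(real ^ 'n \<Rightarrow> real ^ 'n \<Rightarrow> real ^ 'n) \<Rightarrow> (real ^ 'n \<Rightarrow> real ^ 'n \<Rightarrow> real) \<Rightarrow>
    real ^ 'n \<Rightarrow> real ^ 'n" where
  "ricci_operator br g =
     (THE f. linear f \<and> (\<forall>u v. g (f u) v = ricci_curvature br g u v))"

definition algebraic_ricci_soliton ::
  "(real ^ 'n \<Rightarrow> real ^ 'n \<Rightarrow> real ^ 'n) \<Rightarrow> (real ^ 'n \<Rightarrow> real ^ 'n \<Rightarrow> real) \<Rightarrow> bool" where
  "algebraic_ricci_soliton br g \<longleftrightarrow>
     (\<exists>\<eta> D. derivation br D \<and> ricci_operator br g = (\<lambda>x. \<eta> *\<^sub>R x + D x))"

abbreviation basis_vec :: "4 \<Rightarrow> real ^ 4" where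
  "basis_vec i \<equiv> axis i 1"

text \<open>The bracket of the Lie algebra \<open>g\<^sub>3\<^sub>.\<^sub>4\<^sup>\<alpha> \<oplus> g\<^sub>1\<close>: the bilinear, alternating extension of
  \<open>[e\<^sub>2, e\<^sub>3] = e\<^sub>1 - \<alpha> e\<^sub>2\<close> and \<open>[e\<^sub>3, e\<^sub>1] = \<alpha> e\<^sub>1 - e\<^sub>2\<close>. In the index type \<^typ>\<open>4\<close> the
  numeral 4 coincides with 0, so \<open>1, 2, 3, 4\<close> are its four distinct elements.\<close>

definition g34_g1_bracket :: "real \<Rightarrow> real ^ 4 \<Rightarrow> real ^ 4 \<Rightarrow> real ^ 4" where
  "g34_g1_bracket \<alpha> x y =
     (x $ 2 * y $ 3 - x $ 3 * y $ 2) *\<^sub>R (basis_vec 1 - \<alpha> *\<^sub>R basis_vec 2) +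
     (x $ 3 * y $ 1 - x $ 1 * y $ 3) *\<^sub>R (\<alpha> *\<^sub>R basis_vec 1 - basis_vec 2)"

lemma g34_g1_bracket_basis:
  "g34_g1_bracket \<alpha> (basis_vec 2) (basis_vec 3) = basis_vec 1 - \<alpha> *\<^sub>R basis_vec 2"
  "g34_g1_bracket \<alpha> (basis_vec 3) (basis_vec 1) = \<alpha> *\<^sub>R basis_vec 1 - basis_vec 2"
  "g34_g1_bracket \<alpha> (basis_vec 1) (basis_vec 2) = 0"
  "g34_g1_bracket \<alpha> (basis_vec i) (basis_vec 4) = 0"
  by (simp_all add: g34_g1_bracket_def axis_def)

lemma lie_algebra_g34_g1: "lie_algebra (g34_g1_bracket \<alpha>)"
proof -
  have nth: "g34_g1_bracket \<alpha> x y $ 1 = (x $ 2 * y $ 3 - x $ 3 * y $ 2) + \<alpha> * (x $ 3 * y $ 1 - x $ 1 * y $ 3)"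
    "g34_g1_bracket \<alpha> x y $ 2 = - \<alpha> * (x $ 2 * y $ 3 - x $ 3 * y $ 2) - (x $ 3 * y $ 1 - x $ 1 * y $ 3)"
    "g34_g1_bracket \<alpha> x y $ 3 = 0" "g34_g1_bracket \<alpha> x y $ 4 = 0" for x y
    by (simp_all add: g34_g1_bracket_def axis_def)
  have "bilinear (g34_g1_bracket \<alpha>)"
    unfolding bilinear_def by (auto intro!: linearI simp: vec_eq_iff forall_4 nth algebra_simps)
  moreover have "g34_g1_bracket \<alpha> x x = 0" for x
    by (simp add: vec_eq_iff forall_4 nth)
  moreover have "g34_g1_bracket \<alpha> x (g34_g1_bracket \<alpha> y z) + g34_g1_bracket \<alpha> y (g34_g1_bracket \<alpha> z x)
      + g34_g1_bracket \<alpha> z (g34_g1_bracket \<alpha> x y) = 0" for x y z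
    by (simp add: vec_eq_iff forall_4 nth algebra_simps)
  ultimately show ?thesis by (simp add: lie_algebra_def)
qed

end

theory Submission imports Defs begin

text \<open>The matrix \<open>D\<close> of the stated shape is always a derivation: \<open>e\<^sub>1, e\<^sub>2, e\<^sub>4\<close> span an abelian ideal,
  on which \<open>ad e\<^sub>3\<close> acts by a symmetric circulant block on \<open>e\<^sub>1, e\<^sub>2\<close> and by zero on \<open>e\<^sub>4\<close>; \<open>D\<close> maps
  \<open>e\<^sub>3\<close> into this ideal and commutes there with \<open>ad e\<^sub>3\<close>, since circulant \<open>2 \<times> 2\<close> blocks commute.
  The hypotheses on \<open>R\<close> say precisely that \<open>R - R\<^sub>3\<^sub>3 I\<close> has this shape, so it only remains
  to see that the Ricci operator exists as a linear map, which is the Riesz representation theorem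
  for a nondegenerate form, applied first to the Koszul formula and then to the Ricci curvature.\<close>

lemma pseudo_riemannian_unique:
  assumes g: "pseudo_riemannian g" and eq: "\<And>w. g x w = g y w"
  shows "x = y"
proof -
  have bil: "bilinear g"
    using g by (simp add: pseudo_riemannian_def)
  have "g (x - y) w = 0" for w
    using bil eq[of w] by (simp add: bilinear_lsub)
  then have "x - y = 0"
    using g unfolding pseudo_riemannian_def by blast
  then show ?thesis
    by simp
qed

text \<open>Nondegeneracy makes the map sending \<open>x\<close> to the tuple of values of
  \<open>g x\<close> on the standard basis injective, hence surjective by equality of dimensions;
  linear functionals that agree on this basis are equal.\<close>

lemma pseudo_riemannian_riesz:
  fixes g :: "real ^ 'n \<Rightarrow> real ^ 'n \<Rightarrow> real"
  assumes g: "pseudo_riemannian g" and \<phi>: "linear \<phi>"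
  shows "\<exists>!x. \<forall>w. g x w = \<phi> w"
proof (rule ex_ex1I)
  have bil: "bilinear g"
    using g by (simp add: pseudo_riemannian_def)
  then have lin: "linear (g x)" for x
    by (simp add: bilinear_def)
  have eqI: "f = h" if "linear f" "linear h" "\<And>i. f (axis i 1) = h (axis i 1)"
    for f h :: "real ^ 'n \<Rightarrow> real"
    using linear_eq_stdbasis[OF that(1,2)] that(3) by (auto simp: Basis_vec_def fun_eq_iff)
  let ?T = "\<lambda>x. \<chi> i. g x (axis i 1)"
  have "linear ?T"
    by (auto intro!: linearI simp: vec_eq_iff bilinear_ladd[OF bil] bilinear_lmul[OF bil])
  moreover have "inj ?T"
  proof (rule injI)
    fix x y assume "?T x = ?T y"
    then have "g x = g y"
      by (intro eqI lin) (simp add: vec_eq_iff)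
    then show "x = y"
      by (intro pseudo_riemannian_unique[OF g]) simp
  qed
  ultimately have "surj ?T"
    by (rule linear_injective_imp_surjective) simp
  then have "\<exists>x. (\<chi> i. \<phi> (axis i 1)) = ?T x"
    by (rule surjD)
  then obtain x where x: "(\<chi> i. \<phi> (axis i 1)) = ?T x" ..
  have "g x = \<phi>"
    using x by (intro eqI lin \<phi>) (simp add: vec_eq_iff)
  then show "\<exists>x. \<forall>w. g x w = \<phi> w"
    by auto
next
  fix x y assume "\<forall>w. g x w = \<phi> w" "\<forall>w. g y w = \<phi> w"
  then show "x = y"
    by (intro pseudo_riemannian_unique[OF g]) simp
qed

text \<open>Half the right-hand side is linear in \<open>w\<close>, so it is represented by exactly
  one vector, and the definite description in \<open>levi_civita\<close> denotes that
  vector.\<close>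

lemma levi_civita_koszul:
  assumes g: "pseudo_riemannian g" and br: "bilinear br"
  shows "2 * g (levi_civita br g u v) w = g (br u v) w + g (br w u) v + g (br w v) u"
proof -
  have bil: "bilinear g"
    using g by (simp add: pseudo_riemannian_def)
  have "linear (\<lambda>w. (g (br u v) w + g (br w u) v + g (br w v) u) / 2)"
    by (rule linearI) (simp_all add: field_simps bilinear_ladd[OF bil] bilinear_radd[OF bil]
      bilinear_lmul[OF bil] bilinear_rmul[OF bil] bilinear_ladd[OF br] bilinear_lmul[OF br])
  from pseudo_riemannian_riesz[OF g this]
  have "\<exists>!x. \<forall>w. 2 * g x w = g (br u v) w + g (br w u) v + g (br w v) u"
    by (simp add: field_simps)
  from theI'[OF this] show ?thesis
    by (simp add: levi_civita_def)
qed

lemma bilinear_levi_civita: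
  assumes g: "pseudo_riemannian g" and br: "bilinear br"
  shows "bilinear (levi_civita br g)"
proof -
  have bil: "bilinear g"
    using g by (simp add: pseudo_riemannian_def)
  note koszul = levi_civita_koszul[OF g br]
  have eqI: "levi_civita br g u v = x"
    if "\<And>w. 2 * g x w = g (br u v) w + g (br w u) v + g (br w v) u" for u v x
    by (rule pseudo_riemannian_unique[OF g]) (metis koszul that mult_left_cancel zero_neq_numeral)
  \<comment> \<open>The factor 2 stays attached to \<open>g\<close>, so that after splitting every
    term still matches the left side of \<open>koszul\<close>.\<close>
  have add: "2 * g (x + y) w = 2 * g x w + 2 * g y w" for x y w
    by (simp add: bilinear_ladd[OF bil])
  have scale: "2 * g (c *\<^sub>R x) w = c * (2 * g x w)" for c x w
    by (simp add: bilinear_lmul[OF bil])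
  note simps = bilinear_ladd[OF bil] bilinear_radd[OF bil]
    bilinear_lmul[OF bil] bilinear_rmul[OF bil] bilinear_ladd[OF br] bilinear_lmul[OF br]
    bilinear_radd[OF br] bilinear_rmul[OF br]
  show ?thesis
    unfolding bilinear_def
    by (intro conjI allI linearI; rule eqI; unfold add scale koszul;
      simp only: simps real_scaleR_def distrib_left; simp)
qed

lemma bilinear_ricci_curvature:
  assumes g: "pseudo_riemannian g" and br: "bilinear br"
  shows "bilinear (ricci_curvature br g)"
proof -
  note lc = bilinear_levi_civita[OF g br]
  \<comment> \<open>The first and third slots are those that \<open>u\<close> and \<open>v\<close>
    occupy in the trace; the middle slot only receives basis vectors.\<close>
  have "curvature br g (u + u') w v = curvature br g u w v + curvature br g u' w v"
    "curvature br g (c *\<^sub>R u) w v = c *\<^sub>R curvature br g u w v"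
    "curvature br g u w (v + v') = curvature br g u w v + curvature br g u w v'"
    "curvature br g u w (c *\<^sub>R v) = c *\<^sub>R curvature br g u w v" for u u' v v' w c
    by (simp_all add: curvature_def algebra_simps bilinear_ladd[OF lc] bilinear_radd[OF lc]
      bilinear_lmul[OF lc] bilinear_rmul[OF lc] bilinear_ladd[OF br] bilinear_lmul[OF br])
  then show ?thesis
    unfolding bilinear_def ricci_curvature_def trace_def matrix_def
    by (auto intro!: linearI simp: sum.distrib sum_distrib_left)
qed

text \<open>The vectors representing the functionals \<open>ricci_curvature br g u\<close> are
  unique, so they depend linearly on \<open>u\<close>; the same uniqueness identifies the map they
  form with the one described in \<open>ricci_operator\<close>.\<close>

lemma linear_ricci_operator:
  assumes g: "pseudo_riemannian g" and br: "bilinear br"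
  shows "linear (ricci_operator br g)"
proof -
  have bil: "bilinear g"
    using g by (simp add: pseudo_riemannian_def)
  note ric = bilinear_ricci_curvature[OF g br]
  have "linear (ricci_curvature br g u)" for u
    using ric by (simp add: bilinear_def)
  then have "\<exists>x. \<forall>v. g x v = ricci_curvature br g u v" for u
    using pseudo_riemannian_riesz[OF g] by (blast intro: ex1_implies_ex)
  then obtain f where f: "g (f u) v = ricci_curvature br g u v" for u v
    by metis
  have "linear f"
    by (intro linearI pseudo_riemannian_unique[OF g])
      (simp_all add: f bilinear_ladd[OF bil] bilinear_lmul[OF bil]
        bilinear_ladd[OF ric] bilinear_lmul[OF ric])
  moreover have "h = f" if "\<forall>u v. g (h u) v = ricci_curvature br g u v" for h
    by (intro ext pseudo_riemannian_unique[OF g]) (simp add: that f)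
  ultimately have "ricci_operator br g = f"
    unfolding ricci_operator_def using f by (intro the_equality) blast+
  with \<open>linear f\<close> show ?thesis
    by simp
qed

lemma vector_4_nth:
  "(vector [a, b, c, d] :: 'a::zero ^ 4) $ 1 = a"
  "(vector [a, b, c, d] :: 'a::zero ^ 4) $ 2 = b"
  "(vector [a, b, c, d] :: 'a::zero ^ 4) $ 3 = c"
  "(vector [a, b, c, d] :: 'a::zero ^ 4) $ 4 = d"
  by (simp_all add: vector_def)

lemma derivation_g34_g1:
  fixes D :: "real ^ 4 ^ 4"
  assumes "D = vector
    [vector [p, q, a, 0], vector [q, p, b, 0], vector [0, 0, 0, 0], vector [0, 0, c, d]]"
  shows "derivation (g34_g1_bracket \<alpha>) (\<lambda>x. D *v x)"
proof -
  have br: "g34_g1_bracket \<alpha> x y $ 1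
      = x $ 2 * y $ 3 - x $ 3 * y $ 2 + \<alpha> * (x $ 3 * y $ 1 - x $ 1 * y $ 3)"
    "g34_g1_bracket \<alpha> x y $ 2
      = - \<alpha> * (x $ 2 * y $ 3 - x $ 3 * y $ 2) - (x $ 3 * y $ 1 - x $ 1 * y $ 3)"
    "g34_g1_bracket \<alpha> x y $ 3 = 0" "g34_g1_bracket \<alpha> x y $ 4 = 0" for x y
    by (simp_all add: g34_g1_bracket_def axis_def)
  have D: "(D *v x) $ 1 = p * x $ 1 + q * x $ 2 + a * x $ 3"
    "(D *v x) $ 2 = q * x $ 1 + p * x $ 2 + b * x $ 3"
    "(D *v x) $ 3 = 0" "(D *v x) $ 4 = c * x $ 3 + d * x $ 4" for x
    by (simp_all add: assms matrix_vector_mult_def sum_4 vector_4_nth)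
  show ?thesis
    \<comment> \<open>In coordinates the Leibniz rule is a polynomial identity; components 3 and 4
      vanish on both sides, because brackets lie in the span of the first two basis vectors.\<close>
    unfolding derivation_def
    by (simp add: vec_eq_iff forall_4 br D algebra_simps)
qed

theorem theorem3p7:
  fixes \<alpha> :: real and g :: "real ^ 4 \<Rightarrow> real ^ 4 \<Rightarrow> real"
    and R :: "real ^ 4 ^ 4" and D :: "real ^ 4 ^ 4"
  assumes "\<alpha> > 0" and "\<alpha> \<noteq> 1"
    and "pseudo_riemannian g"
    and R_def: "R = matrix (ricci_operator (g34_g1_bracket \<alpha>) g)"
    and "\<forall>i \<in> {3, 4}. R $ i $ 1 = 0 \<and> R $ i $ 2 = 0"
    and "\<forall>i \<in> {1, 2, 3}. R $ i $ 4 = 0"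
    and "R $ 2 $ 1 = R $ 1 $ 2"
    and "R $ 2 $ 2 = R $ 1 $ 1"
    and D_def: "D = vector
      [vector [R $ 1 $ 1 - R $ 3 $ 3, R $ 1 $ 2, R $ 1 $ 3, 0],
       vector [R $ 1 $ 2, R $ 1 $ 1 - R $ 3 $ 3, R $ 2 $ 3, 0],
       vector [0, 0, 0, 0],
       vector [0, 0, R $ 4 $ 3, R $ 4 $ 4 - R $ 3 $ 3]]"
  shows "algebraic_ricci_soliton (g34_g1_bracket \<alpha>) g \<and>
    ricci_operator (g34_g1_bracket \<alpha>) g = (\<lambda>x. (R $ 3 $ 3) *\<^sub>R x + D *v x) \<and>
    R = (R $ 3 $ 3) *\<^sub>R mat 1 + D \<and>
    derivation (g34_g1_bracket \<alpha>) (\<lambda>x. D *v x)"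
proof -
  let ?br = "g34_g1_bracket \<alpha>"
  have "linear (ricci_operator ?br g)"
    using linear_ricci_operator \<open>pseudo_riemannian g\<close> lie_algebra_g34_g1
    unfolding lie_algebra_def by blast
  \<comment> \<open>A matrix records only the values on the basis; linearity recovers the operator
    from them.\<close>
  then have ric: "ricci_operator ?br g = (\<lambda>x. R *v x)"
    by (simp add: R_def matrix_works fun_eq_iff)
  have R: "R = (R $ 3 $ 3) *\<^sub>R mat 1 + D"
    using assms(5-8) by (simp add: D_def vec_eq_iff forall_4 vector_4_nth mat_def)
  \<comment> \<open>As \<open>R\<close> recurs on the right of this equation, it is applied once by
    congruence; rewriting with it would loop.\<close>
  have "R *v x = ((R $ 3 $ 3) *\<^sub>R mat 1 + D) *v x" for x
    by (rule arg_cong[OF R])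
  then have "R *v x = (R $ 3 $ 3) *\<^sub>R x + D *v x" for x
    by (simp add: matrix_vector_mult_add_rdistrib flip: scaleR_matrix_vector_assoc)
  with ric have eq: "ricci_operator ?br g = (\<lambda>x. (R $ 3 $ 3) *\<^sub>R x + D *v x)"
    by simp
  have der: "derivation ?br (\<lambda>x. D *v x)"
    using D_def by (rule derivation_g34_g1)
  then have "algebraic_ricci_soliton ?br g"
    unfolding algebraic_ricci_soliton_def using eq by blast
  with eq R der show ?thesis
    by blast
qed

end
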